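(* Let $T>0$, $r>0$, $\rho\ge 0$, $\sigma>0$, $c>0$, and let $\alpha:[0,T]\to[0,\infty)$ be a time profile satisfying the standing assumptions of the context. Let $\nu$ be a Lévy measure on $\mathbb{R}_0=\mathbb{R}\setminus\{0\}$ with finite large-jump intensity $\lambda:=\nu(\{|z|>1\})<\infty$. Let $M>0$ be a given constant with $$r+\rho<\sqrt{\lambda}\,M,\qquad\text{and set}\qquad \beta:=\sqrt{\lambda}\,M-(r+\rho)>0.$$ Fix a constant $C_{\max}>0$. Suppose that there exist $\tau\in(0,T)$ and $\alpha_*>0$ such that $\alpha(t)\ge\alpha_*$ for all $t\in[0,\tau]$. Then, whenever $\tau$ satisfies $$\tau>T_{\mathrm{crit}}:=\frac1\beta\log\left(\frac{C_{\max}}{\alpha_*}\right),$$ there exists an admissible jump amplitude $\gamma_*$ with $L^2(\nu)$-Lipschitz constant $M$ for which there is no nonnegative lower semicontinuous function $v^T:\mathbb{R}\times[0,T]\to[0,\infty)$ satisfying the growth bound $$v^T(g,t)\le C_{\max}(1+|g|),\qquad (g,t)\in\mathbb{R}\times[0,T],$$ that simultaneously satisfies the obstacle inequality $$v^T(g,t)-v^T(-g,t)\ge\alpha(t)g-c,\qquad (g,t)\in\mathbb{R}\times(0,T),$$ and the viscosity supersolution inequality for the integro-differential operator $\mathcal{L}^\nu$ (with jump amplitude $\gamma=\gamma_*$) on $\mathbb{R}\times(0,T)$.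
   Context: Standing assumptions on the time profile: $\alpha\in C^1([0,T])$, $\alpha(t)\ge 0$ for all $t\in[0,T]$, $\alpha\not\equiv 0$, $\alpha(T)=0$, and $\alpha'(t)\le 0$ for all $t$. Lévy measure: a Borel measure $\nu$ on $\mathbb{R}_0=\mathbb{R}\setminus\{0\}$ with $\int_{\mathbb{R}_0}\min(1,z^2)\,\nu(dz)<\infty$. Admissible jump amplitude with $L^2(\nu)$-Lipschitz constant $L_\gamma>0$: a function $\gamma:\mathbb{R}\times\mathbb{R}_0\to\mathbb{R}$ such that (1) for every $g\in\mathbb{R}$ the map $z\mapsto\gamma(g,z)$ is Borel measurable on $\mathbb{R}_0$, and for every $z\in\mathbb{R}_0$ the map $g\mapsto\gamma(g,z)$ is continuous; (2) $\int_{\mathbb{R}_0}|\gamma(x,z)-\gamma(y,z)|^2\,\nu(dz)\le L_\gamma^2|x-y|^2$ for all $x,y\in\mathbb{R}$, and $\int_{\mathbb{R}_0}|\gamma(0,z)|^2\,\nu(dz)<\infty$; (3) there is $K_1>0$ with $\sup_{0<|z|\le 1}\frac{|\gamma(g,z)|}{|z|}\le K_1(1+|g|)$ for all $g\in\mathbb{R}$; (4) there is $\epsilon\in(0,1)$ with $\limsup_{|g|\to\infty}\sup_{0<|z|\le1}\frac{|\gamma(g,z)|}{|g|}\le 1-\epsilon$. Operator (for sufficiently smooth $w$): $$\mathcal{L}^{\nu}w=w_t-\rho g\,w_g+\frac{\sigma^2}{2}w_{gg}+\int_{\mathbb{R}_0}\left[w(g+\gamma(g,z),t)-w(g,t)-\gamma(g,z)w_g(g,t)\mathbf{1}_{\{|z|\le1\}}\right]\nu(dz)-rw.$$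 Split test operator: for $\delta\in(0,1)$, $\varphi\in C^{2,1}(\mathbb{R}\times[0,T))$ ($C^2$ in $g$, $C^1$ in $t$) and a function $w$, set $$\mathcal{I}^{1,\delta}[\varphi](g,t):=\int_{0<|z|\le\delta}\left[\varphi(g+\gamma(g,z),t)-\varphi(g,t)-\gamma(g,z)\varphi_g(g,t)\right]\nu(dz),$$ $$\mathcal{I}^{2,\delta}[w,\varphi](g,t):=\int_{|z|>\delta}\left[w(g+\gamma(g,z),t)-w(g,t)-\gamma(g,z)\varphi_g(g,t)\mathbf{1}_{\{|z|\le1\}}\right]\nu(dz),$$ $$\mathcal{L}^{\nu,\delta}[\varphi,w](g,t):=\varphi_t-\rho g\,\varphi_g+\frac{\sigma^2}{2}\varphi_{gg}-r\,w(g,t)+\mathcal{I}^{1,\delta}[\varphi](g,t)+\mathcal{I}^{2,\delta}[w,\varphi](g,t).$$ Viscosity supersolution inequality for $\mathcal{L}^\nu$ on $\mathbb{R}\times(0,T)$: a lower semicontinuous $v:\mathbb{R}\times[0,T]\to\mathbb{R}$ of at most linear growth satisfies it if, whenever $\varphi\in C^{2,1}(\mathbb{R}\times[0,T))$ is such that $v-\varphi$ attains a global minimum over $\mathbb{R}\times[0,T)$ at a point $(g_0,t_0)\in\mathbb{R}\times(0,T)$ with $v(g_0,t_0)=\varphi(g_0,t_0)$, one has $-\mathcal{L}^{\nu,\delta}[\varphi,v](g_0,t_0)\ge 0$ for every $\delta\in(0,1)$. *)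

theory Defs
  imports "HOL-Analysis.Analysis"
begin

text \<open>The condition involves only the values of \<open>\<alpha>\<close> on \<open>[0,T]\<close>; at the end points the derivative
  is one-sided.\<close>

definition time_profile :: "real \<Rightarrow> (real \<Rightarrow> real) \<Rightarrow> bool" where
  "time_profile T \<alpha> \<longleftrightarrow>
     (\<exists>\<alpha>'. (\<forall>t\<in>{0..T}. (\<alpha> has_real_derivative \<alpha>' t) (at t within {0..T})) \<and>
           continuous_on {0..T} \<alpha>' \<and>
           (\<forall>t\<in>{0..T}. \<alpha>' t \<le> 0)) \<and>
     (\<forall>t\<in>{0..T}. 0 \<le> \<alpha> t) \<and>
     (\<exists>t\<in>{0..T}. \<alpha> t \<noteq> 0) \<and>
     \<alpha> T = 0"

abbreviation borel_R0 :: "real measure" where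
  "borel_R0 \<equiv> restrict_space borel (- {0})"

text \<open>The first condition makes \<open>\<nu>\<close> a Borel measure on the punctured line; in particular
  \<open>space \<nu> = - {0}\<close>.\<close>

definition levy_measure :: "real measure \<Rightarrow> bool" where
  "levy_measure \<nu> \<longleftrightarrow>
     sets \<nu> = sets borel_R0 \<and> (\<integral>\<^sup>+ z. ennreal (min 1 (z\<^sup>2)) \<partial>\<nu>) < \<infinity>"

text \<open>The value \<open>\<gamma> g 0\<close> is never used. Suprema and the upper limit are taken in the extended reals,
  so that no boundedness is presupposed.\<close>

definition admissible_jump_amplitude ::
    "real measure \<Rightarrow> real \<Rightarrow> (real \<Rightarrow> real \<Rightarrow> real) \<Rightarrow> bool" where
  "admissible_jump_amplitude \<nu> L \<gamma> \<longleftrightarrow>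
     L > 0 \<and>
     (\<forall>g. \<gamma> g \<in> borel_measurable borel_R0) \<and>
     (\<forall>z. z \<noteq> 0 \<longrightarrow> continuous_on UNIV (\<lambda>g. \<gamma> g z)) \<and>
     (\<forall>x y. (\<integral>\<^sup>+ z. ennreal (\<bar>\<gamma> x z - \<gamma> y z\<bar>\<^sup>2) \<partial>\<nu>) \<le> ennreal (L\<^sup>2 * \<bar>x - y\<bar>\<^sup>2)) \<and>
     (\<integral>\<^sup>+ z. ennreal (\<bar>\<gamma> 0 z\<bar>\<^sup>2) \<partial>\<nu>) < \<infinity> \<and>
     (\<exists>K>0. \<forall>g. (SUP z\<in>{z. 0 < \<bar>z\<bar> \<and> \<bar>z\<bar> \<le> 1}. ereal (\<bar>\<gamma> g z\<bar> / \<bar>z\<bar>)) \<le> ereal (K * (1 + \<bar>g\<bar>))) \<and>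
     (\<exists>\<epsilon>. 0 < \<epsilon> \<and> \<epsilon> < 1 \<and>
        Limsup at_infinity (\<lambda>g. SUP z\<in>{z. 0 < \<bar>z\<bar> \<and> \<bar>z\<bar> \<le> 1}. ereal (\<bar>\<gamma> g z\<bar> / \<bar>g\<bar>))
          \<le> ereal (1 - \<epsilon>))"

text \<open>The class \<open>C\<^sup>2\<^sup>,\<^sup>1\<close> on \<open>\<real> \<times> [0,T)\<close>: the function and the derivatives \<open>\<phi>\<^sub>t\<close>, \<open>\<phi>\<^sub>g\<close>, \<open>\<phi>\<^sub>g\<^sub>g\<close> are
  jointly continuous there, the time derivative at \<open>t = 0\<close> being one-sided.\<close>

definition C21_on :: "real \<Rightarrow> (real \<Rightarrow> real \<Rightarrow> real) \<Rightarrow> bool" where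
  "C21_on T \<phi> \<longleftrightarrow>
     (\<exists>\<phi>t \<phi>g \<phi>gg.
        (\<forall>g. \<forall>t\<in>{0..<T}.
           ((\<lambda>s. \<phi> g s) has_real_derivative \<phi>t g t) (at t within {0..<T}) \<and>
           ((\<lambda>x. \<phi> x t) has_real_derivative \<phi>g g t) (at g) \<and>
           ((\<lambda>x. \<phi>g x t) has_real_derivative \<phi>gg g t) (at g)) \<and>
        continuous_on (UNIV \<times> {0..<T}) (\<lambda>(g, t). \<phi> g t) \<and>
        continuous_on (UNIV \<times> {0..<T}) (\<lambda>(g, t). \<phi>t g t) \<and>
        continuous_on (UNIV \<times> {0..<T}) (\<lambda>(g, t). \<phi>g g t) \<and>
        continuous_on (UNIV \<times> {0..<T}) (\<lambda>(g, t). \<phi>gg g t))"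

text \<open>For \<open>\<gamma>\<close> admissible, \<open>\<phi>\<close> of class \<open>C\<^sup>2\<^sup>,\<^sup>1\<close> and \<open>w\<close> lower semicontinuous of linear growth, the
  integrands below are absolutely integrable, so the Bochner integral never takes its default
  value \<open>0\<close>: near the origin by Taylor's formula and \<open>\<bar>\<gamma> g z\<bar> \<le> K (1 + \<bar>g\<bar>) \<bar>z\<bar>\<close>, away from it because
  \<open>\<nu> {z. \<delta> < \<bar>z\<bar>}\<close> is finite and \<open>\<gamma> g\<close> is square integrable.\<close>

definition small_jumps ::
    "real measure \<Rightarrow> (real \<Rightarrow> real \<Rightarrow> real) \<Rightarrow> real \<Rightarrow>
     (real \<Rightarrow> real \<Rightarrow> real) \<Rightarrow> real \<Rightarrow> real \<Rightarrow> real" where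
  "small_jumps \<nu> \<gamma> \<delta> \<phi> g t =
     (LINT z:{z. 0 < \<bar>z\<bar> \<and> \<bar>z\<bar> \<le> \<delta>}|\<nu>.
        \<phi> (g + \<gamma> g z) t - \<phi> g t - \<gamma> g z * deriv (\<lambda>x. \<phi> x t) g)"

definition large_jumps ::
    "real measure \<Rightarrow> (real \<Rightarrow> real \<Rightarrow> real) \<Rightarrow> real \<Rightarrow>
     (real \<Rightarrow> real \<Rightarrow> real) \<Rightarrow> (real \<Rightarrow> real \<Rightarrow> real) \<Rightarrow> real \<Rightarrow> real \<Rightarrow> real" where
  "large_jumps \<nu> \<gamma> \<delta> w \<phi> g t =
     (LINT z:{z. \<delta> < \<bar>z\<bar>}|\<nu>.
        w (g + \<gamma> g z) t - w g t
          - \<gamma> g z * deriv (\<lambda>x. \<phi> x t) g * indicat_real {z. \<bar>z\<bar> \<le> 1} z)"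

definition split_operator ::
    "real \<Rightarrow> real \<Rightarrow> real \<Rightarrow> real measure \<Rightarrow> (real \<Rightarrow> real \<Rightarrow> real) \<Rightarrow> real \<Rightarrow>
     (real \<Rightarrow> real \<Rightarrow> real) \<Rightarrow> (real \<Rightarrow> real \<Rightarrow> real) \<Rightarrow> real \<Rightarrow> real \<Rightarrow> real" where
  "split_operator r \<rho> \<sigma> \<nu> \<gamma> \<delta> \<phi> w g t =
     deriv (\<lambda>s. \<phi> g s) t - \<rho> * g * deriv (\<lambda>x. \<phi> x t) g
       + \<sigma>\<^sup>2 / 2 * deriv (deriv (\<lambda>x. \<phi> x t)) g - r * w g t
       + small_jumps \<nu> \<gamma> \<delta> \<phi> g t + large_jumps \<nu> \<gamma> \<delta> w \<phi> g t"

definition lower_semicontinuous_on :: "'a::topological_space set \<Rightarrow> ('a \<Rightarrow> real) \<Rightarrow> bool" where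
  "lower_semicontinuous_on S f \<longleftrightarrow>
     (\<forall>x\<in>S. \<forall>a < f x. eventually (\<lambda>y. a < f y) (at x within S))"

definition viscosity_supersolution ::
    "real \<Rightarrow> real \<Rightarrow> real \<Rightarrow> real \<Rightarrow> real measure \<Rightarrow> (real \<Rightarrow> real \<Rightarrow> real) \<Rightarrow>
     (real \<Rightarrow> real \<Rightarrow> real) \<Rightarrow> bool" where
  "viscosity_supersolution T r \<rho> \<sigma> \<nu> \<gamma> v \<longleftrightarrow>
     lower_semicontinuous_on (UNIV \<times> {0..T}) (\<lambda>(g, t). v g t) \<and>
     (\<exists>C. \<forall>g. \<forall>t\<in>{0..T}. \<bar>v g t\<bar> \<le> C * (1 + \<bar>g\<bar>)) \<and>
     (\<forall>\<phi> g0 t0.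
        C21_on T \<phi> \<longrightarrow> t0 \<in> {0<..<T} \<longrightarrow>
        (\<forall>g. \<forall>t\<in>{0..<T}. v g0 t0 - \<phi> g0 t0 \<le> v g t - \<phi> g t) \<longrightarrow>
        v g0 t0 = \<phi> g0 t0 \<longrightarrow>
        (\<forall>\<delta>\<in>{0<..<1}. - split_operator r \<rho> \<sigma> \<nu> \<gamma> \<delta> \<phi> v g0 t0 \<ge> 0))"

end

theory Submission
  imports Defs
begin

text \<open>
  Take the amplitude \<open>\<kappa> g\<close> for \<open>\<bar>z\<bar> > 1\<close> and \<open>0\<close> for \<open>\<bar>z\<bar> \<le> 1\<close>, with \<open>\<kappa> = M / sqrt \<lambda>\<close>. Its
  \<open>L\<^sup>2(\<nu>)\<close>-Lipschitz constant is exactly \<open>M\<close>, and the jumps give the linear function \<open>g\<close> the growth rate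
  \<open>\<lambda> \<kappa> = sqrt \<lambda> M\<close>. Against mean reversion \<open>\<rho>\<close> and discounting \<open>r\<close> the net rate is \<open>\<beta> > 0\<close>, so
  \<open>exp (- \<beta> t) g\<close> solves the equation. Since \<open>v \<ge> 0\<close>, the obstacle inequality gives
  \<open>v g t \<ge> \<alpha>\<^sub>* g - c\<close> up to time \<open>\<tau>\<close>, and comparison with this solution carries the bound
  backwards in time and amplifies it: \<open>v g t \<ge> \<alpha>\<^sub>* exp (\<beta> (\<tau> - t)) g - c\<close> for \<open>0 < t < \<tau>\<close>
  (\<open>supersolution_lower_bound\<close>). As \<open>g \<rightarrow> \<infinity>\<close> the growth bound forces
  \<open>\<alpha>\<^sub>* exp (\<beta> (\<tau> - t)) \<le> C\<^sub>m\<^sub>a\<^sub>x\<close>, which is false for small \<open>t\<close> because \<open>\<tau>\<close> exceeds the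
  critical time.

  The comparison needs no doubling of variables, because the subsolution is smooth and can itself be
  the test function (\<open>supersolution_lower_bound_perturbed\<close>). It is modified so that the minimum of
  the difference is attained at an interior time. A quadratic penalty
  \<open>\<epsilon> exp (- C t) (1 + g\<^sup>2)\<close> confines the minimum in \<open>g\<close>; for \<open>C\<close> large its own contribution has the
  favourable sign. The linear part is multiplied by a \<open>C\<^sup>1\<close> plateau \<open>p\<close> in time which vanishes at
  \<open>t = 0\<close>, where the only lower bound on \<open>v\<close> is \<open>v \<ge> 0\<close>, and from \<open>\<tau>\<close> on, where the obstacle may
  have disappeared. The increase of \<open>p\<close> is harmless since it only helps a subsolution; the
  decrease takes place where \<open>v\<close> is already known to lie above the test function.
\<close>

section \<open>Lower semicontinuous functions\<close>

lemma lower_semicontinuous_on_subset: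
  "lower_semicontinuous_on S f \<Longrightarrow> K \<subseteq> S \<Longrightarrow> lower_semicontinuous_on K f"
  unfolding lower_semicontinuous_on_def
  by (meson at_le filter_leD subsetD)

lemma lower_semicontinuous_on_diff_continuous:
  fixes f h :: "'a::topological_space \<Rightarrow> real"
  assumes f: "lower_semicontinuous_on S f" and h: "continuous_on S h"
  shows "lower_semicontinuous_on S (\<lambda>x. f x - h x)"
  unfolding lower_semicontinuous_on_def
proof (intro ballI allI impI)
  fix x a assume x: "x \<in> S" and a: "a < f x - h x"
  define e where "e = (f x - h x - a) / 2"
  have e: "e > 0" using a by (simp add: e_def)
  have "eventually (\<lambda>y. f x - e < f y) (at x within S)"
    using f x e unfolding lower_semicontinuous_on_def by simp
  moreover have "eventually (\<lambda>y. h y < h x + e) (at x within S)"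
    using h x e by (auto simp: continuous_on_def intro: order_tendstoD)
  ultimately show "eventually (\<lambda>y. a < f y - h y) (at x within S)"
    by eventually_elim (use e_def in \<open>simp add: field_simps\<close>)
qed

lemma lower_semicontinuous_attains_inf:
  fixes f :: "'a::topological_space \<Rightarrow> real"
  assumes K: "compact K" "K \<noteq> {}" and f: "lower_semicontinuous_on K f"
  shows "\<exists>x\<in>K. \<forall>y\<in>K. f x \<le> f y"
proof (rule ccontr)
  \<comment> \<open>If every value is undercut by some value \<open>f (w x)\<close>, then it is undercut by this same value
    throughout a neighbourhood; finitely many neighbourhoods cover \<open>K\<close>, and the least of the finitely
    many \<open>f (w x)\<close> is not undercut.\<close>
  assume "\<not> ?thesis"
  then have *: "\<forall>x\<in>K. \<exists>y\<in>K. f y < f x" by (force simp: not_le)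
  have "\<exists>U. open U \<and> x \<in> U \<and> (\<exists>y\<in>K. \<forall>x'\<in>U \<inter> K. f y < f x')" if x: "x \<in> K" for x
  proof -
    obtain y where y: "y \<in> K" "f y < f x" using * x by blast
    then have "eventually (\<lambda>x'. f y < f x') (at x within K)"
      using f x unfolding lower_semicontinuous_on_def by blast
    then obtain U where "open U" "x \<in> U" "\<forall>x'\<in>U. x' \<noteq> x \<longrightarrow> x' \<in> K \<longrightarrow> f y < f x'"
      unfolding eventually_at_topological by blast
    then show ?thesis using y by (intro exI[of _ U]) auto
  qed
  then obtain U w where U: "\<And>x. x \<in> K \<Longrightarrow> open (U x)" "\<And>x. x \<in> K \<Longrightarrow> x \<in> U x"
      "\<And>x. x \<in> K \<Longrightarrow> w x \<in> K" "\<And>x x'. x \<in> K \<Longrightarrow> x' \<in> U x \<inter> K \<Longrightarrow> f (w x) < f x'"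
    by metis
  obtain C where C: "C \<subseteq> K" "finite C" "K \<subseteq> (\<Union>x\<in>C. U x)"
    using compactE_image[OF K(1), of K U] U by blast
  have ne: "C \<noteq> {}" using C K by auto
  obtain x0 where x0: "x0 \<in> C" "\<And>x. x \<in> C \<Longrightarrow> f (w x0) \<le> f (w x)"
    using arg_min_if_finite(1)[OF C(2) ne, of "\<lambda>x. f (w x)"]
      arg_min_least[OF C(2) ne, of _ "\<lambda>x. f (w x)"] that by blast
  have "w x0 \<in> K" using U C x0 by blast
  then obtain x where "x \<in> C" "w x0 \<in> U x" using C by blast
  then have "f (w x) < f (w x0)" using U C \<open>w x0 \<in> K\<close> by blast
  with x0 \<open>x \<in> C\<close> show False by force
qed

section \<open>A plateau function of class \<open>C\<^sup>1\<close>\<close>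

lemma has_real_derivative_max_0_squared:
  "((\<lambda>x::real. (max 0 x)\<^sup>2) has_real_derivative 2 * max 0 x) (at x)"
proof -
  consider "x > 0" | "x < 0" | "x = 0" by linarith
  then show ?thesis
  proof cases
    case 1
    have "((\<lambda>x::real. x\<^sup>2) has_real_derivative 2 * max 0 x) (at x)"
      using 1 by (auto intro!: derivative_eq_intros)
    then show ?thesis
      by (rule has_field_derivative_transform_within_open[of _ _ _ "{0<..}"]) (use 1 in auto)
  next
    case 2
    have "((\<lambda>x::real. 0) has_real_derivative 2 * max 0 x) (at x)"
      using 2 by (auto intro!: derivative_eq_intros)
    then show ?thesis
      by (rule has_field_derivative_transform_within_open[of _ _ _ "{..<0}"]) (use 2 in auto)
  next
    case 3
    have "((\<lambda>h::real. max 0 h) \<longlongrightarrow> max 0 0) (at 0)"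
      by (intro tendsto_intros)
    moreover have "eventually (\<lambda>h::real. max 0 h = ((max 0 (0 + h))\<^sup>2 - (max 0 0)\<^sup>2) / h) (at 0)"
      by (auto simp: eventually_at_filter max_def power2_eq_square)
    ultimately show ?thesis
      using 3 by (auto simp: DERIV_def intro: Lim_transform_eventually)
  qed
qed

text \<open>The plateau rises on \<open>[0, s]\<close> and falls on \<open>[\<tau>', \<tau>]\<close>. It is built from squares of positive parts,
  which are of class \<open>C\<^sup>1\<close>: the factor \<open>u\<close> provides the rise and the factor \<open>w\<close> the fall.\<close>

lemma C1_plateau:
  fixes s \<tau>' \<tau> :: real
  assumes "0 < s" "s < \<tau>'" "\<tau>' < \<tau>"
  obtains p p' :: "real \<Rightarrow> real"
    where "\<And>t. (p has_real_derivative p' t) (at t)" "continuous_on UNIV p'"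
      "p 0 = 0" "p s = 1" "\<And>t. 0 \<le> t \<Longrightarrow> 0 \<le> p t" "\<And>t. 0 \<le> t \<Longrightarrow> p t \<le> 1"
      "\<And>t. t \<ge> \<tau> \<Longrightarrow> p t = 0" "\<And>t. t \<le> \<tau>' \<Longrightarrow> 0 \<le> p' t"
proof
  define u where "u t = 1 - (max 0 (1 - t / s))\<^sup>2" for t
  define u' where "u' t = 2 * max 0 (1 - t / s) / s" for t
  define y where "y t = 1 - (max 0 (t - \<tau>'))\<^sup>2 / (\<tau> - \<tau>')\<^sup>2" for t
  define y' where "y' t = - (2 * max 0 (t - \<tau>')) / (\<tau> - \<tau>')\<^sup>2" for t
  define w where "w t = (max 0 (y t))\<^sup>2" for t
  define w' where "w' t = 2 * max 0 (y t) * y' t" for t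
  let ?p = "\<lambda>t. u t * w t" and ?p' = "\<lambda>t. u' t * w t + u t * w' t"
  have sq: "((\<lambda>t. (max 0 (f t))\<^sup>2) has_real_derivative 2 * max 0 (f t) * f') (at t)"
    if "(f has_real_derivative f') (at t)" for f f' t
    using DERIV_chain2[OF has_real_derivative_max_0_squared that] .
  have u: "(u has_real_derivative u' t) (at t)" for t
  proof -
    have "((\<lambda>t. 1 - t / s) has_real_derivative - (1 / s)) (at t)"
      using assms by (auto intro!: derivative_eq_intros)
    from DERIV_diff[OF DERIV_const[of 1] sq[OF this]] show ?thesis
      unfolding u_def u'_def by simp
  qed
  have y: "(y has_real_derivative y' t) (at t)" for t
  proof -
    have "((\<lambda>t. t - \<tau>') has_real_derivative 1) (at t)"
      by (auto intro!: derivative_eq_intros)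
    from DERIV_diff[OF DERIV_const[of 1] DERIV_cdivide[OF sq[OF this]]] show ?thesis
      unfolding y_def y'_def by simp
  qed
  have w: "(w has_real_derivative w' t) (at t)" for t
    unfolding w_def w'_def by (rule sq[OF y])
  show "(?p has_real_derivative ?p' t) (at t)" for t
    by (auto intro!: derivative_eq_intros u w)
  have cu: "continuous_on UNIV u" and cy: "continuous_on UNIV y" and cw: "continuous_on UNIV w"
    using u y w by (meson DERIV_isCont continuous_at_imp_continuous_on)+
  have "continuous_on UNIV u'" "continuous_on UNIV y'"
    unfolding u'_def y'_def using assms by (auto intro!: continuous_intros)
  moreover from this have "continuous_on UNIV w'"
    unfolding w'_def using cy by (intro continuous_intros)
  ultimately show "continuous_on UNIV ?p'"
    using cu cw by (intro continuous_intros)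
  have y1: "y t = 1" if "t \<le> \<tau>'" for t using that by (simp add: y_def)
  have y0: "y t \<le> 0" if "t \<ge> \<tau>" for t
  proof -
    have "(\<tau> - \<tau>')\<^sup>2 \<le> (max 0 (t - \<tau>'))\<^sup>2"
      using that assms by (intro power_mono) auto
    then show ?thesis using assms by (simp add: y_def)
  qed
  have yle: "y t \<le> 1" for t by (simp add: y_def)
  have w01: "0 \<le> w t" "w t \<le> 1" for t
    using yle[of t] by (auto simp: w_def power_le_one)
  have u01: "0 \<le> u t" "u t \<le> 1" if "0 \<le> t" for t
    using that assms by (auto simp: u_def power_le_one)
  show "?p 0 = 0" by (simp add: u_def)
  show "?p s = 1" using assms y1[of s] by (simp add: u_def w_def)
  show "0 \<le> ?p t" if "0 \<le> t" for t using u01 w01 that by simp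
  show "?p t \<le> 1" if "0 \<le> t" for t using u01[OF that] w01[of t] by (simp add: mult_le_one)
  show "?p t = 0" if "t \<ge> \<tau>" for t using y0[OF that] by (simp add: w_def max_def)
  show "0 \<le> ?p' t" if "t \<le> \<tau>'" for t
    using y1[OF that] that assms by (simp add: w_def w'_def y'_def u'_def)
qed

section \<open>Large jumps proportional to the state\<close>

definition proportional_jump :: "real \<Rightarrow> real \<Rightarrow> real \<Rightarrow> real" where
  "proportional_jump \<kappa> g z = \<kappa> * g * indicat_real {z. \<bar>z\<bar> > 1} z"

lemma levy_measure_large_jumps_sets:
  assumes "levy_measure \<nu>"
  shows "{z. \<bar>z\<bar> > 1} \<in> sets \<nu>"
proof -
  have "{z::real. \<bar>z\<bar> > 1} = -{0} \<inter> {z. \<bar>z\<bar> > 1}" by auto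
  moreover have "{z::real. \<bar>z\<bar> > 1} \<in> sets borel" by measurable
  ultimately have "{z::real. \<bar>z\<bar> > 1} \<in> sets borel_R0"
    by (subst sets_restrict_space) (auto intro!: image_eqI)
  then show ?thesis using assms by (simp add: levy_measure_def)
qed

text \<open>Small jumps are absent, so the conditions on \<open>0 < \<bar>z\<bar> \<le> 1\<close> are trivial, and the difference of
  two amplitudes is constant in \<open>z\<close> on the set of large jumps, so the Lipschitz bound holds with
  equality.\<close>

lemma proportional_jump_admissible:
  assumes nu: "levy_measure \<nu>"
    and fin: "emeasure \<nu> {z. \<bar>z\<bar> > 1} < \<infinity>"
    and L: "L > 0" "L\<^sup>2 = \<kappa>\<^sup>2 * measure \<nu> {z. \<bar>z\<bar> > 1}"
  shows "admissible_jump_amplitude \<nu> L (proportional_jump \<kappa>)"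
proof -
  let ?J = "{z::real. \<bar>z\<bar> > 1}"
  have J: "?J \<in> sets \<nu>" by (rule levy_measure_large_jumps_sets[OF nu])
  have eq: "\<bar>proportional_jump \<kappa> x z - proportional_jump \<kappa> y z\<bar>\<^sup>2 =
      \<kappa>\<^sup>2 * \<bar>x - y\<bar>\<^sup>2 * indicat_real ?J z" for x y z
    by (simp add: proportional_jump_def indicator_def power2_eq_square algebra_simps)
  have nn: "(\<integral>\<^sup>+ z. ennreal (k * indicat_real ?J z) \<partial>\<nu>) = ennreal (k * measure \<nu> ?J)"
    if "k \<ge> 0" for k
  proof -
    have "(\<integral>\<^sup>+ z. ennreal (k * indicat_real ?J z) \<partial>\<nu>) = (\<integral>\<^sup>+ z. ennreal k * indicator ?J z \<partial>\<nu>)"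
      by (intro nn_integral_cong) (auto simp: indicator_def)
    also have "\<dots> = ennreal k * emeasure \<nu> ?J"
      using J by (rule nn_integral_cmult_indicator)
    also have "emeasure \<nu> ?J = ennreal (measure \<nu> ?J)"
      using fin by (intro emeasure_eq_ennreal_measure) auto
    finally show ?thesis using that by (simp add: ennreal_mult)
  qed
  have small: "proportional_jump \<kappa> g z = 0" if "\<bar>z\<bar> \<le> 1" for g z
    using that by (simp add: proportional_jump_def)
  have ne: "{z::real. 0 < \<bar>z\<bar> \<and> \<bar>z\<bar> \<le> 1} \<noteq> {}" by (auto intro: exI[of _ 1])
  have sup0: "(SUP z\<in>{z. 0 < \<bar>z\<bar> \<and> \<bar>z\<bar> \<le> 1}. ereal (\<bar>proportional_jump \<kappa> g z\<bar> / f z)) = 0" for g f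
  proof -
    have "(SUP z\<in>{z. 0 < \<bar>z\<bar> \<and> \<bar>z\<bar> \<le> 1}. ereal (\<bar>proportional_jump \<kappa> g z\<bar> / f z))
        = (SUP z\<in>{z::real. 0 < \<bar>z\<bar> \<and> \<bar>z\<bar> \<le> 1}. 0)"
      by (rule SUP_cong) (auto simp: small)
    then show ?thesis using ne by simp
  qed
  show ?thesis
    unfolding admissible_jump_amplitude_def
  proof (intro conjI allI impI)
    show "proportional_jump \<kappa> g \<in> borel_measurable borel_R0" for g
      unfolding proportional_jump_def
      by (rule measurable_restrict_space1) measurable
    show "continuous_on UNIV (\<lambda>g. proportional_jump \<kappa> g z)" for z
      unfolding proportional_jump_def by (intro continuous_intros)
    show "(\<integral>\<^sup>+ z. ennreal (\<bar>proportional_jump \<kappa> x z - proportional_jump \<kappa> y z\<bar>\<^sup>2) \<partial>\<nu>)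
        \<le> ennreal (L\<^sup>2 * \<bar>x - y\<bar>\<^sup>2)" for x y
      unfolding eq L(2) by (subst nn) (simp_all add: mult_ac)
    show "(\<integral>\<^sup>+ z. ennreal (\<bar>proportional_jump \<kappa> 0 z\<bar>\<^sup>2) \<partial>\<nu>) < \<infinity>"
      by (simp add: proportional_jump_def)
    show "\<exists>K>0. \<forall>g. (SUP z\<in>{z. 0 < \<bar>z\<bar> \<and> \<bar>z\<bar> \<le> 1}. ereal (\<bar>proportional_jump \<kappa> g z\<bar> / \<bar>z\<bar>))
        \<le> ereal (K * (1 + \<bar>g\<bar>))"
      by (intro exI[of _ 1]) (simp only: sup0, simp)
    show "\<exists>\<epsilon>. 0 < \<epsilon> \<and> \<epsilon> < 1 \<and>
        Limsup at_infinity (\<lambda>g. SUP z\<in>{z. 0 < \<bar>z\<bar> \<and> \<bar>z\<bar> \<le> 1}. ereal (\<bar>proportional_jump \<kappa> g z\<bar> / \<bar>g\<bar>))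
          \<le> ereal (1 - \<epsilon>)"
      by (intro exI[of _ "1/2"] conjI) (simp_all only: sup0, simp_all add: Limsup_const[OF trivial_limit_at_infinity])
  qed (use L in auto)
qed

text \<open>With splitting parameter \<open>1/2\<close> the small-jump part and the compensator vanish, and the integrand
  of the large-jump part is a constant on \<open>\<bar>z\<bar> > 1\<close> and zero elsewhere.\<close>

lemma split_operator_proportional_jump:
  fixes A B :: "real \<Rightarrow> real"
  assumes nu: "levy_measure \<nu>"
    and fin: "emeasure \<nu> {z. \<bar>z\<bar> > 1} < \<infinity>"
    and A: "(A has_real_derivative A') (at t)" and B: "(B has_real_derivative B') (at t)"
  shows "split_operator r \<rho> \<sigma> \<nu> (proportional_jump \<kappa>) (1/2)
      (\<lambda>g t. A t * g - B t * (1 + g\<^sup>2) + k) w g t =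
    (A' * g - B' * (1 + g\<^sup>2)) - \<rho> * g * (A t - 2 * B t * g) - \<sigma>\<^sup>2 * B t - r * w g t
      + measure \<nu> {z. \<bar>z\<bar> > 1} * (w ((1 + \<kappa>) * g) t - w g t)"
proof -
  let ?\<phi> = "\<lambda>g t. A t * g - B t * (1 + g\<^sup>2) + k"
  let ?J = "{z::real. \<bar>z\<bar> > 1}"
  have dt: "deriv (\<lambda>s. ?\<phi> g s) t = A' * g - B' * (1 + g\<^sup>2)"
    by (intro DERIV_imp_deriv) (auto intro!: derivative_eq_intros A B)
  have dg: "deriv (\<lambda>x. ?\<phi> x t) = (\<lambda>x. A t - 2 * B t * x)"
    by (intro ext DERIV_imp_deriv) (auto intro!: derivative_eq_intros)
  have dgg: "deriv (\<lambda>x. A t - 2 * B t * x) g = - 2 * B t"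
    by (intro DERIV_imp_deriv) (auto intro!: derivative_eq_intros)
  have small: "small_jumps \<nu> (proportional_jump \<kappa>) (1/2) ?\<phi> g t = 0"
  proof -
    have "small_jumps \<nu> (proportional_jump \<kappa>) (1/2) ?\<phi> g t = (LINT z|\<nu>. 0)"
      unfolding small_jumps_def set_lebesgue_integral_def
      by (intro Bochner_Integration.integral_cong)
         (auto simp: proportional_jump_def indicator_def)
    then show ?thesis by simp
  qed
  have large: "large_jumps \<nu> (proportional_jump \<kappa>) (1/2) w ?\<phi> g t =
      measure \<nu> ?J * (w ((1 + \<kappa>) * g) t - w g t)"
  proof -
    have "large_jumps \<nu> (proportional_jump \<kappa>) (1/2) w ?\<phi> g t =
        (LINT z|\<nu>. indicat_real ?J z *\<^sub>R (w ((1 + \<kappa>) * g) t - w g t))"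
      unfolding large_jumps_def set_lebesgue_integral_def
      by (intro Bochner_Integration.integral_cong)
         (auto simp: proportional_jump_def indicator_def algebra_simps)
    also have "\<dots> = measure \<nu> ?J * (w ((1 + \<kappa>) * g) t - w g t)"
      using levy_measure_large_jumps_sets[OF nu] fin
      by (subst Bochner_Integration.integral_scaleR_left) (auto simp: Int_absorb1 sets.sets_into_space)
    finally show ?thesis .
  qed
  show ?thesis
    unfolding split_operator_def dt dg dgg small large by (simp add: algebra_simps)
qed

lemma C21_on_quadratic:
  fixes A B A' B' :: "real \<Rightarrow> real"
  assumes A: "\<And>t. (A has_real_derivative A' t) (at t)" "continuous_on UNIV A'"
    and B: "\<And>t. (B has_real_derivative B' t) (at t)" "continuous_on UNIV B'"
  shows "C21_on T (\<lambda>g t. A t * g - B t * (1 + g\<^sup>2) + k)"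
proof -
  have "continuous_on UNIV A" "continuous_on UNIV B"
    using A B by (meson DERIV_isCont continuous_at_imp_continuous_on)+
  then have c: "continuous_on (UNIV \<times> {0..<T}) (\<lambda>x. A (snd x))"
      "continuous_on (UNIV \<times> {0..<T}) (\<lambda>x. B (snd x))"
      "continuous_on (UNIV \<times> {0..<T}) (\<lambda>x. A' (snd x))"
      "continuous_on (UNIV \<times> {0..<T}) (\<lambda>x. B' (snd x))"
    using A(2) B(2)
    by (auto intro!: continuous_on_compose2[of UNIV _ _ snd] continuous_intros)
  show ?thesis
    unfolding C21_on_def split_beta
    by (rule exI[of _ "\<lambda>g t. A' t * g - B' t * (1 + g\<^sup>2)"], rule exI[of _ "\<lambda>g t. A t - 2 * B t * g"],
        rule exI[of _ "\<lambda>g t. - 2 * B t"])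
       (auto intro!: derivative_eq_intros DERIV_subset[OF A(1)] DERIV_subset[OF B(1)]
          continuous_intros c)
qed

section \<open>Backward propagation of a linear lower bound\<close>

text \<open>Comparison of \<open>v\<close> with \<open>\<psi> = A(t) g - B(t) (1 + g\<^sup>2) - c\<close>, where
  \<open>A(t) = a exp (\<beta> (\<tau>' - t)) p(t)\<close>, \<open>B(t) = \<epsilon> exp (- C t)\<close> and \<open>p\<close> is the plateau. If \<open>v - \<psi>\<close> took a
  negative value, it would have a negative minimum \<open>m\<close>, and \<open>\<psi> + m\<close> would be a test function
  touching \<open>v\<close> from below at a point \<open>(g\<^sub>0, t\<^sub>0)\<close> where the operator is strictly positive: the terms in
  \<open>A\<close> add up to \<open>a exp (\<beta> (\<tau>' - t\<^sub>0)) p'(t\<^sub>0) g\<^sub>0 \<ge> 0\<close>, those in \<open>B\<close> are nonnegative, and discounting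
  the constant \<open>m - c < 0\<close> leaves \<open>r (c - m) > 0\<close>.
  The interval from \<open>\<tau>'\<close> to \<open>\<tau>\<close> gives the plateau room to fall.\<close>

lemma supersolution_lower_bound_perturbed:
  fixes v :: "real \<Rightarrow> real \<Rightarrow> real" and \<nu> :: "real measure"
  defines "lam \<equiv> measure \<nu> {z. \<bar>z\<bar> > 1}"
  assumes nu: "levy_measure \<nu>" and fin: "emeasure \<nu> {z. \<bar>z\<bar> > 1} < \<infinity>"
    and pos: "r > 0" "\<rho> \<ge> 0" "\<kappa> \<ge> 0" "c > 0" "a > 0"
    and \<beta>: "\<beta> = lam * \<kappa> - (r + \<rho>)" "\<beta> > 0"
    and times: "0 < s" "s < \<tau>'" "\<tau>' < \<tau>" "\<tau> < T"
    and nonneg: "\<And>g t. t \<in> {0..T} \<Longrightarrow> 0 \<le> v g t"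
    and super: "viscosity_supersolution T r \<rho> \<sigma> \<nu> (proportional_jump \<kappa>) v"
    and lower: "\<And>g t. 0 < t \<Longrightarrow> t \<le> \<tau> \<Longrightarrow> 0 < g \<Longrightarrow> a * g - c \<le> v g t"
    and \<epsilon>: "\<epsilon> > 0"
  shows "a * exp (\<beta> * (\<tau>' - s)) * g - c - \<epsilon> * (1 + g\<^sup>2) \<le> v g s"
proof (rule ccontr)
  assume contra: "\<not> ?thesis"
  obtain p p' where p: "\<And>t. (p has_real_derivative p' t) (at t)" "continuous_on UNIV p'"
      "p 0 = 0" "p s = 1" "\<And>t. 0 \<le> t \<Longrightarrow> 0 \<le> p t" "\<And>t. 0 \<le> t \<Longrightarrow> p t \<le> 1"
      "\<And>t. t \<ge> \<tau> \<Longrightarrow> p t = 0" "\<And>t. t \<le> \<tau>' \<Longrightarrow> 0 \<le> p' t"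
    using C1_plateau[OF times(1-3)] by metis
  \<comment> \<open>The second moment term \<open>\<sigma>\<^sup>2 + lam ((1 + \<kappa>)\<^sup>2 - 1) g\<^sup>2\<close> generated by the penalty is at most
    \<open>C (1 + g\<^sup>2)\<close>, so that its decay in time compensates it.\<close>
  define C where "C = \<sigma>\<^sup>2 + lam * (1 + \<kappa>)\<^sup>2"
  define A where "A t = a * exp (\<beta> * (\<tau>' - t)) * p t" for t
  define A' where "A' t = a * exp (\<beta> * (\<tau>' - t)) * p' t - \<beta> * A t" for t
  define B where "B t = \<epsilon> * exp (- C * t)" for t
  define B' where "B' t = - C * B t" for t
  define \<psi> where "\<psi> k g t = A t * g - B t * (1 + g\<^sup>2) + k" for k g t
  have lam0: "lam \<ge> 0" by (simp add: lam_def)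
  have C0: "C \<ge> 0" using lam0 by (simp add: C_def)
  have cp: "continuous_on UNIV p"
    using p(1) by (meson DERIV_isCont continuous_at_imp_continuous_on)
  have A: "(A has_real_derivative A' t) (at t)" for t
    unfolding A_def A'_def by (auto intro!: derivative_eq_intros p(1) simp: algebra_simps)
  have B: "(B has_real_derivative B' t) (at t)" for t
    unfolding B_def B'_def by (auto intro!: derivative_eq_intros)
  have cA': "continuous_on UNIV A'" unfolding A'_def A_def
    using p(2) cp by (intro continuous_intros)
  have cB': "continuous_on UNIV B'" unfolding B'_def B_def by (intro continuous_intros)
  have cA: "continuous_on UNIV A" unfolding A_def using cp by (intro continuous_intros)
  have cB: "continuous_on UNIV B" unfolding B_def by (intro continuous_intros)
  have c\<psi>: "continuous_on X (\<lambda>(g, t). \<psi> (- c) g t)" for X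
    unfolding \<psi>_def split_beta
    by (auto intro!: continuous_intros continuous_on_compose2[OF cA] continuous_on_compose2[OF cB])
  have A0: "A t \<ge> 0" if "0 \<le> t" for t using p(5)[OF that] pos by (simp add: A_def)
  have Bpos: "B t > 0" for t using \<epsilon> by (simp add: B_def)

  \<comment> \<open>Where \<open>v\<close> lies below \<open>\<psi>\<close>, both \<open>A t\<close> and \<open>g\<close> are positive, so the time is interior, and
    \<open>A t > a\<close> by the lower bound, so \<open>t < \<tau>'\<close>, where the plateau is still nondecreasing.\<close>
  have below: "0 < g \<and> 0 < t \<and> t < \<tau>'" if "v g t < \<psi> (- c) g t" "0 \<le> t" "t < T" for g t
  proof -
    have "0 \<le> v g t" using nonneg that by simp
    moreover have "B t * (1 + g\<^sup>2) > 0" using Bpos by (intro mult_pos_pos) (auto intro: add_pos_nonneg)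
    ultimately have v: "v g t < A t * g - c" and Ag: "0 < A t * g" using that pos by (auto simp: \<psi>_def)
    from Ag have g: "0 < g" and At: "A t \<noteq> 0" using A0[OF that(2)] by (auto simp: zero_less_mult_iff)
    have "t \<noteq> 0" "\<not> \<tau> \<le> t" using At p(3) p(7)[of t] by (auto simp: A_def)
    then have t: "0 < t" "t < \<tau>" using that(2) by auto
    have "a * g < A t * g" using lower[of t g] t g v by linarith
    then have "a < A t" using g by simp
    also have "A t \<le> a * exp (\<beta> * (\<tau>' - t))"
      using p(6)[OF that(2)] pos by (simp add: A_def)
    finally have "1 < exp (\<beta> * (\<tau>' - t))" using pos by simp
    then have "t < \<tau>'" using \<beta>(2) by (simp add: zero_less_mult_iff)
    with g t show ?thesis by simp
  qed
  have neg: "v g s < \<psi> (- c) g s"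
  proof -
    have "B s \<le> \<epsilon>" using \<epsilon> C0 times by (simp add: B_def)
    then have "B s * (1 + g\<^sup>2) \<le> \<epsilon> * (1 + g\<^sup>2)" by (intro mult_right_mono) auto
    then show ?thesis using contra p(4) by (simp add: \<psi>_def A_def)
  qed

  \<comment> \<open>Beyond \<open>R\<close> the penalty dominates the linear term at all times.\<close>
  define a1 where "a1 = a * exp (\<beta> * \<tau>')"
  define R where "R = a1 / B T"
  have big: "\<psi> (- c) g t \<le> 0" if "R \<le> g" "0 \<le> t" "t < T" for g t
  proof -
    have g0: "0 \<le> g" using that(1) pos Bpos[of T] by (auto simp: R_def a1_def intro: order.trans[rotated])
    have "A t \<le> a1 * 1"
      unfolding A_def a1_def using that pos \<beta>(2) times
      by (intro mult_mono p(6) p(5)) (auto simp: algebra_simps)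
    also have "a1 \<le> B T * g" using that(1) Bpos[of T] by (simp add: R_def field_simps)
    also have "B T \<le> B t" using that \<epsilon> C0 by (auto simp: B_def mult_left_mono)
    finally have "A t * g \<le> B t * g * g" using g0 by (auto intro!: mult_right_mono)
    then show ?thesis using Bpos[of t] pos by (simp add: \<psi>_def power2_eq_square algebra_simps)
  qed

  \<comment> \<open>All points where \<open>v < \<psi>\<close> lie in the compact set \<open>K\<close>, so a minimum over \<open>K\<close> is a global one.\<close>
  define K where "K = {0..R} \<times> {0..\<tau>}"
  have inK: "(g, t) \<in> K" if "v g t < \<psi> (- c) g t" "0 \<le> t" "t < T" for g t
  proof -
    have "0 \<le> v g t" using nonneg that by simp
    then have "g \<le> R" using big[of g t] that by linarith
    then show ?thesis using below[OF that] times by (auto simp: K_def)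
  qed
  have "lower_semicontinuous_on (UNIV \<times> {0..T}) (\<lambda>(g, t). v g t)"
    using super by (simp add: viscosity_supersolution_def)
  then have "lower_semicontinuous_on K (\<lambda>(g, t). v g t)"
    by (rule lower_semicontinuous_on_subset) (use times in \<open>auto simp: K_def\<close>)
  from lower_semicontinuous_on_diff_continuous[OF this c\<psi>]
  have "lower_semicontinuous_on K (\<lambda>x. (\<lambda>(g, t). v g t) x - (\<lambda>(g, t). \<psi> (- c) g t) x)" .
  moreover have gsK: "(g, s) \<in> K" using inK[OF neg] times by simp
  moreover have "compact K" unfolding K_def by (intro compact_Times) auto
  ultimately obtain g0 t0 where g0t0: "(g0, t0) \<in> K"
      "\<And>g t. (g, t) \<in> K \<Longrightarrow> v g0 t0 - \<psi> (- c) g0 t0 \<le> v g t - \<psi> (- c) g t"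
    using lower_semicontinuous_attains_inf[of K] by fastforce
  define m where "m = v g0 t0 - \<psi> (- c) g0 t0"
  have m: "m < 0" using g0t0(2)[OF gsK] neg by (simp add: m_def)
  have t0T: "0 \<le> t0" "t0 < T" using g0t0(1) times by (auto simp: K_def)
  have g0: "0 < g0" and t0: "0 < t0" "t0 < \<tau>'" using below[of g0 t0] m t0T by (auto simp: m_def)
  have min: "m \<le> v g t - \<psi> (- c) g t" if "0 \<le> t" "t < T" for g t
    using g0t0(2)[of g t] inK[of g t] that m unfolding m_def[symmetric] by linarith

  define k where "k = m - c"
  have \<psi>k: "\<psi> k g t = \<psi> (- c) g t + m" for g t by (simp add: \<psi>_def k_def)
  have touch: "v g0 t0 = \<psi> k g0 t0" by (simp add: \<psi>k m_def)
  have above: "\<psi> k g t \<le> v g t" if "0 \<le> t" "t < T" for g t using min[OF that, of g] by (simp add: \<psi>k)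
  have "C21_on T (\<psi> k)"
    unfolding \<psi>_def by (rule C21_on_quadratic[OF A cA' B cB'])
  then have "0 \<le> - split_operator r \<rho> \<sigma> \<nu> (proportional_jump \<kappa>) (1/2) (\<psi> k) v g0 t0"
    using super above touch t0T t0 unfolding viscosity_supersolution_def by auto
  then have "split_operator r \<rho> \<sigma> \<nu> (proportional_jump \<kappa>) (1/2) (\<psi> k) v g0 t0 \<le> 0" by simp
  then have le0: "(A' t0 * g0 - B' t0 * (1 + g0\<^sup>2)) - \<rho> * g0 * (A t0 - 2 * B t0 * g0) - \<sigma>\<^sup>2 * B t0
      - r * v g0 t0 + lam * (v ((1 + \<kappa>) * g0) t0 - v g0 t0) \<le> 0"
    unfolding \<psi>_def[abs_def] split_operator_proportional_jump[OF nu fin A B] lam_def .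
  have "lam * (\<psi> k ((1 + \<kappa>) * g0) t0 - \<psi> k g0 t0) \<le> lam * (v ((1 + \<kappa>) * g0) t0 - v g0 t0)"
    using lam0 above[OF t0T] touch by (intro mult_left_mono) auto
  \<comment> \<open>Since \<open>v\<close> lies above the touching test function, \<open>v\<close> may be replaced by it in the jump term.\<close>
  with le0 have "(A' t0 * g0 - B' t0 * (1 + g0\<^sup>2)) - \<rho> * g0 * (A t0 - 2 * B t0 * g0) - \<sigma>\<^sup>2 * B t0
      - r * \<psi> k g0 t0 + lam * (\<psi> k ((1 + \<kappa>) * g0) t0 - \<psi> k g0 t0) \<le> 0"
    using touch by simp
  also have "(A' t0 * g0 - B' t0 * (1 + g0\<^sup>2)) - \<rho> * g0 * (A t0 - 2 * B t0 * g0) - \<sigma>\<^sup>2 * B t0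
      - r * \<psi> k g0 t0 + lam * (\<psi> k ((1 + \<kappa>) * g0) t0 - \<psi> k g0 t0)
    = a * exp (\<beta> * (\<tau>' - t0)) * p' t0 * g0 - r * k
      + B t0 * (\<sigma>\<^sup>2 * g0\<^sup>2 + lam * (1 + \<kappa>)\<^sup>2 + lam * g0\<^sup>2 + 2 * \<rho> * g0\<^sup>2 + r * (1 + g0\<^sup>2))"
    unfolding \<psi>_def A'_def B'_def C_def \<beta>(1) by (simp add: algebra_simps power2_eq_square)
  finally have "a * exp (\<beta> * (\<tau>' - t0)) * p' t0 * g0 - r * k
      + B t0 * (\<sigma>\<^sup>2 * g0\<^sup>2 + lam * (1 + \<kappa>)\<^sup>2 + lam * g0\<^sup>2 + 2 * \<rho> * g0\<^sup>2 + r * (1 + g0\<^sup>2)) \<le> 0" .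
  moreover have "a * exp (\<beta> * (\<tau>' - t0)) * p' t0 * g0 \<ge> 0"
    using p(8)[of t0] t0 g0 pos by simp
  moreover have "r * k < 0" using m pos by (simp add: k_def mult_less_0_iff)
  moreover have "B t0 * (\<sigma>\<^sup>2 * g0\<^sup>2 + lam * (1 + \<kappa>)\<^sup>2 + lam * g0\<^sup>2 + 2 * \<rho> * g0\<^sup>2 + r * (1 + g0\<^sup>2)) \<ge> 0"
    using Bpos[of t0] lam0 pos by (intro mult_nonneg_nonneg add_nonneg_nonneg) auto
  ultimately show False by linarith
qed

text \<open>The perturbed bound with \<open>\<tau>' = \<tau> - e\<close> and \<open>\<epsilon> = e\<close>, as \<open>e\<close> tends to \<open>0\<close>.\<close>

lemma supersolution_lower_bound:
  fixes v :: "real \<Rightarrow> real \<Rightarrow> real"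
  assumes nu: "levy_measure \<nu>" and fin: "emeasure \<nu> {z. \<bar>z\<bar> > 1} < \<infinity>"
    and pos: "r > 0" "\<rho> \<ge> 0" "\<kappa> \<ge> 0" "c > 0" "a > 0"
    and \<beta>: "\<beta> = measure \<nu> {z. \<bar>z\<bar> > 1} * \<kappa> - (r + \<rho>)" "\<beta> > 0"
    and times: "0 < s" "s < \<tau>" "\<tau> < T"
    and nonneg: "\<And>g t. t \<in> {0..T} \<Longrightarrow> 0 \<le> v g t"
    and super: "viscosity_supersolution T r \<rho> \<sigma> \<nu> (proportional_jump \<kappa>) v"
    and lower: "\<And>g t. 0 < t \<Longrightarrow> t \<le> \<tau> \<Longrightarrow> 0 < g \<Longrightarrow> a * g - c \<le> v g t"
  shows "a * exp (\<beta> * (\<tau> - s)) * g - c \<le> v g s"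
proof (rule tendsto_upperbound)
  let ?f = "\<lambda>e. a * exp (\<beta> * (\<tau> - e - s)) * g - c - e * (1 + g\<^sup>2)"
  have "(?f \<longlongrightarrow> a * exp (\<beta> * (\<tau> - 0 - s)) * g - c - 0 * (1 + g\<^sup>2)) (at_right 0)"
    by (intro tendsto_intros)
  then show "(?f \<longlongrightarrow> a * exp (\<beta> * (\<tau> - s)) * g - c) (at_right 0)" by simp
  have "eventually (\<lambda>e. e \<in> {0<..<\<tau> - s}) (at_right 0)"
    using times by (intro eventually_at_right_real) auto
  then show "eventually (\<lambda>e. ?f e \<le> v g s) (at_right 0)"
  proof eventually_elim
    case (elim e)
    show ?case
      by (rule supersolution_lower_bound_perturbed[OF nu fin pos \<beta> times(1) _ _ times(3) nonneg super lower])
         (use elim in auto)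
  qed
qed simp

lemma linear_bounds_slope_le:
  fixes C D c :: real
  assumes "\<And>g. g > 0 \<Longrightarrow> D * g - c \<le> C * (1 + g)"
  shows "D \<le> C"
proof (rule ccontr)
  assume "\<not> D \<le> C"
  then have d: "D - C > 0" by simp
  define g where "g = (\<bar>C + c\<bar> + 1) / (D - C)"
  have "g > 0" using d by (simp add: g_def)
  moreover have "(D - C) * g = \<bar>C + c\<bar> + 1" using d by (simp add: g_def)
  ultimately show False using assms[of g] by (simp add: algebra_simps)
qed

theorem theorem3p6:
  fixes T r \<rho> \<sigma> c lam M \<beta> Cmax \<tau> \<alpha>_star Tcrit :: real
    and \<alpha> :: "real \<Rightarrow> real"
    and \<nu> :: "real measure"
  assumes "T > 0" and "r > 0" and "\<rho> \<ge> 0" and "\<sigma> > 0" and "c > 0"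
    and "time_profile T \<alpha>"
    and "levy_measure \<nu>"
    and "emeasure \<nu> {z. \<bar>z\<bar> > 1} < \<infinity>"
    and "lam = measure \<nu> {z. \<bar>z\<bar> > 1}"
    and "M > 0"
    and "r + \<rho> < sqrt lam * M"
    and "\<beta> = sqrt lam * M - (r + \<rho>)"
    and "Cmax > 0"
    and "\<tau> \<in> {0<..<T}" and "\<alpha>_star > 0"
    and "\<forall>t\<in>{0..\<tau>}. \<alpha> t \<ge> \<alpha>_star"
    and "Tcrit = 1 / \<beta> * ln (Cmax / \<alpha>_star)"
    and "\<tau> > Tcrit"
  shows "\<exists>\<gamma>_star. admissible_jump_amplitude \<nu> M \<gamma>_star \<and>
           \<not> (\<exists>v :: real \<Rightarrow> real \<Rightarrow> real.
                (\<forall>g. \<forall>t\<in>{0..T}. 0 \<le> v g t) \<and>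
                lower_semicontinuous_on (UNIV \<times> {0..T}) (\<lambda>(g, t). v g t) \<and>
                (\<forall>g. \<forall>t\<in>{0..T}. v g t \<le> Cmax * (1 + \<bar>g\<bar>)) \<and>
                (\<forall>g. \<forall>t\<in>{0<..<T}. v g t - v (- g) t \<ge> \<alpha> t * g - c) \<and>
                viscosity_supersolution T r \<rho> \<sigma> \<nu> \<gamma>_star v)"
proof -
  have \<beta>0: "\<beta> > 0" using assms by simp
  have "0 < sqrt lam * M" using assms by linarith
  then have lam: "lam > 0" using \<open>M > 0\<close> by (simp add: zero_less_mult_iff)
  define \<kappa> where "\<kappa> = M / sqrt lam"
  have \<kappa>: "\<kappa> \<ge> 0" using lam \<open>M > 0\<close> by (simp add: \<kappa>_def)
  have lam\<kappa>: "lam * \<kappa> = sqrt lam * M"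
    using real_div_sqrt[of lam] lam by (simp add: \<kappa>_def flip: times_divide_eq_left)
  have M2: "M\<^sup>2 = \<kappa>\<^sup>2 * lam" using lam by (simp add: \<kappa>_def power_divide)
  have "\<not> (\<exists>v :: real \<Rightarrow> real \<Rightarrow> real.
                (\<forall>g. \<forall>t\<in>{0..T}. 0 \<le> v g t) \<and>
                lower_semicontinuous_on (UNIV \<times> {0..T}) (\<lambda>(g, t). v g t) \<and>
                (\<forall>g. \<forall>t\<in>{0..T}. v g t \<le> Cmax * (1 + \<bar>g\<bar>)) \<and>
                (\<forall>g. \<forall>t\<in>{0<..<T}. v g t - v (- g) t \<ge> \<alpha> t * g - c) \<and>
                viscosity_supersolution T r \<rho> \<sigma> \<nu> (proportional_jump \<kappa>) v)"
  proof clarify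
    fix v :: "real \<Rightarrow> real \<Rightarrow> real"
    assume v: "\<forall>g. \<forall>t\<in>{0..T}. 0 \<le> v g t" "\<forall>g. \<forall>t\<in>{0..T}. v g t \<le> Cmax * (1 + \<bar>g\<bar>)"
        "\<forall>g. \<forall>t\<in>{0<..<T}. v g t - v (- g) t \<ge> \<alpha> t * g - c"
        "viscosity_supersolution T r \<rho> \<sigma> \<nu> (proportional_jump \<kappa>) v"
    have lower: "\<alpha>_star * g - c \<le> v g t" if "0 < t" "t \<le> \<tau>" "0 < g" for g t
    proof -
      have "\<alpha> t * g - c \<le> v g t - v (- g) t" "0 \<le> v (- g) t" using v that assms by auto
      moreover have "\<alpha>_star * g \<le> \<alpha> t * g" using that assms by (intro mult_right_mono) auto
      ultimately show ?thesis by linarith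
    qed
    \<comment> \<open>The critical time is negative if \<open>Cmax < \<alpha>_star\<close>, hence the maximum.\<close>
    define s where "s = (\<tau> - max Tcrit 0) / 2"
    have s: "0 < s" "s < \<tau>" "Tcrit < \<tau> - s" using assms by (auto simp: s_def max_def field_simps)
    have "\<alpha>_star * exp (\<beta> * (\<tau> - s)) * g - c \<le> Cmax * (1 + g)" if "g > 0" for g
    proof -
      have "\<alpha>_star * exp (\<beta> * (\<tau> - s)) * g - c \<le> v g s"
        by (rule supersolution_lower_bound[where \<kappa> = \<kappa> and \<rho> = \<rho> and T = T and \<nu> = \<nu> and \<sigma> = \<sigma> and r = r])
           (use assms \<kappa> \<beta>0 lam\<kappa> s v lower in auto)
      also have "v g s \<le> Cmax * (1 + \<bar>g\<bar>)"
        using v(2) s assms by auto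
      finally show ?thesis using that by simp
    qed
    then have "\<alpha>_star * exp (\<beta> * (\<tau> - s)) \<le> Cmax" by (rule linear_bounds_slope_le)
    then have "exp (\<beta> * (\<tau> - s)) \<le> Cmax / \<alpha>_star"
      using \<open>\<alpha>_star > 0\<close> by (simp add: pos_le_divide_eq mult.commute)
    then have "\<beta> * (\<tau> - s) \<le> ln (Cmax / \<alpha>_star)"
      using assms by (simp add: ln_ge_iff)
    then have "\<tau> - s \<le> Tcrit"
      using \<beta>0 by (simp add: \<open>Tcrit = _\<close> pos_le_divide_eq mult.commute)
    with s show False by simp
  qed
  moreover have "admissible_jump_amplitude \<nu> M (proportional_jump \<kappa>)"
    using assms M2 by (intro proportional_jump_admissible) auto
  ultimately show ?thesis by blast
qed

end
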